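(* Let $\mathbb{G}$ be a stratified Lie group of homogeneous dimension $Q$. Let $0<s<1<p<\infty$, $Q>ps$ and $p<q<p_s^*:=\frac{Qp}{Q-ps}$. Let $C_{S,\mathbb{G}}>0$ be the least positive constant $C$ such that $$\left(\int_{\mathbb{G}}|u|^qdx\right)^{\frac pq}\le C\left[\int_{\mathbb{G}}\int_{\mathbb{G}}\frac{|u(x)-u(y)|^p}{|y^{-1}x|^{Q+ps}}dxdy+\int_{\mathbb{G}}|u|^pdx\right]$$ for all $u\in W_0^{s,p}(\mathbb{G})$, i.e. $$C_{S,\mathbb{G}}^{-1}=\inf_{u\in W_0^{s,p}(\mathbb{G})\setminus\{0\}}\frac{\int_{\mathbb{G}}\int_{\mathbb{G}}\frac{|u(x)-u(y)|^p}{|y^{-1}x|^{Q+ps}}dxdy+\int_{\mathbb{G}}|u|^pdx}{\left(\int_{\mathbb{G}}|u|^qdx\right)^{p/q}}.$$ Let $\phi$ be a least energy solution of $(-\Delta_{p,\mathbb{G}})^su+|u|^{p-2}u=|u|^{q-2}u$, $u\in W_0^{s,p}(\mathbb{G})$, and let $d=I(\phi)=\inf_{u\in\mathcal{N}}I(u)$. Then $$C_{S,\mathbb{G}}^{-1}=\left(\frac{spq}{spq-Q(q-p)}\int_{\mathbb{G}}|\phi(x)|^pdx\right)^{\frac{q-p}{q}}=\left(\frac{pq}{q-p}\,d\right)^{\frac{q-p}{q}}.$$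
   Context: Stratified Lie group: a Lie group $\mathbb{G}=(\mathbb{R}^N,\circ)$ with a decomposition $\mathbb{R}^N=\mathbb{R}^{N_1}\times\cdots\times\mathbb{R}^{N_k}$ such that (i) for each $\lambda>0$ the dilation $D_\lambda(x)=(\lambda x^{(1)},\lambda^2x^{(2)},\dots,\lambda^kx^{(k)})$, $x^{(i)}\in\mathbb{R}^{N_i}$, is an automorphism of $\mathbb{G}$; (ii) if $X_1,\dots,X_{N_1}$ are the left-invariant vector fields with $X_j(0)=\partial/\partial x_j|_0$, then the Lie algebra they generate has rank $N$ at every point. Its homogeneous dimension is $Q=\sum_{i=1}^k iN_i$. Haar measure $dx$ is Lebesgue measure on $\mathbb{R}^N$. $|\cdot|:\mathbb{G}\to[0,\infty)$ is a fixed homogeneous quasi-norm: continuous, $|x|=0$ iff $x=0$, $|x^{-1}|=|x|$, $|D_\lambda x|=\lambda|x|$ for $\lambda>0$. Write $y^{-1}x=y^{-1}\circ x$. $W^{s,p}(\mathbb{G})=\{u\in L^p(\mathbb{G}):[u]_{s,p}<\infty\}$, with $[u]_{s,p}^p=\iint_{\mathbb{G}\times\mathbb{G}}\frac{|u(x)-u(y)|^p}{|y^{-1}x|^{Q+ps}}dxdy$ and norm $\|u\|_{W^{s,p}}^p=\|u\|_{L^p}^p+[u]_{s,p}^p$; $W_0^{s,p}(\mathbb{G})$ is the closure of $C_c^\infty(\mathbb{G})$ in this norm (it equals $W^{s,p}(\mathbb{G})$). The equation is understood weakly: $u\in W_0^{s,p}(\mathbb{G})$ is a weak solution if for all $\psi\in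 W_0^{s,p}(\mathbb{G})$ $$\iint_{\mathbb{G}\times\mathbb{G}}\frac{|u(x)-u(y)|^{p-2}(u(x)-u(y))(\psi(x)-\psi(y))}{|y^{-1}x|^{Q+ps}}dxdy+\int_{\mathbb{G}}(|u|^{p-2}u\psi-|u|^{q-2}u\psi)dx=0.$$ Energy: $I(u)=\frac1p[u]_{s,p}^p+\frac1p\int_{\mathbb{G}}|u|^pdx-\frac1q\int_{\mathbb{G}}|u|^qdx$ on $W_0^{s,p}(\mathbb{G})$; the left-hand side of the weak formulation is $\langle I'(u),\psi\rangle$. Set $\mathcal{L}(u)=\langle I'(u),u\rangle=[u]_{s,p}^p+\int_{\mathbb{G}}(|u|^p-|u|^q)dx$ and $\mathcal{N}=\{u\in W_0^{s,p}(\mathbb{G})\setminus\{0\}:\mathcal{L}(u)=0\}$. Let $\Gamma$ be the set of nonzero weak solutions. A least energy solution is a $u\in\Gamma$ with $I(u)\le I(v)$ for all $v\in\Gamma$. *)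

theory Defs
  imports "HOL-Analysis.Analysis" "HOL-Algebra.Group"
begin

section \<open>Smooth functions and left-invariant vector fields\<close>

primrec Ck :: "nat \<Rightarrow> ('a::euclidean_space \<Rightarrow> 'b::real_normed_vector) \<Rightarrow> bool" where
  "Ck 0 f \<longleftrightarrow> continuous_on UNIV f"
| "Ck (Suc k) f \<longleftrightarrow>
     (\<forall>x. f differentiable (at x)) \<and> (\<forall>v. Ck k (\<lambda>x. frechet_derivative f (at x) v))"

definition smooth :: "('a::euclidean_space \<Rightarrow> 'b::real_normed_vector) \<Rightarrow> bool" where
  "smooth f \<longleftrightarrow> (\<forall>k. Ck k f)"

definition test_function :: "('a::euclidean_space \<Rightarrow> real) \<Rightarrow> bool" where
  "test_function f \<longleftrightarrow> smooth f \<and> compact (closure {x. f x \<noteq> 0})"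

text \<open>
  A vector field on $\mathbb{R}^N$ is identified with its coefficient function; the bracket is
  the commutator of the corresponding first-order differential operators.
\<close>

definition lie_bracket :: "('a::euclidean_space \<Rightarrow> 'a) \<Rightarrow> ('a \<Rightarrow> 'a) \<Rightarrow> 'a \<Rightarrow> 'a" where
  "lie_bracket X Y x =
     frechet_derivative Y (at x) (X x) - frechet_derivative X (at x) (Y x)"

inductive_set generated_lie_algebra ::
    "('a::euclidean_space \<Rightarrow> 'a) set \<Rightarrow> ('a \<Rightarrow> 'a) set" for S where
  base: "X \<in> S \<Longrightarrow> X \<in> generated_lie_algebra S"
| lincomb: "\<lbrakk>X \<in> generated_lie_algebra S; Y \<in> generated_lie_algebra S\<rbrakk>
    \<Longrightarrow> (\<lambda>x. a *\<^sub>R X x + b *\<^sub>R Y x) \<in> generated_lie_algebra S"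
| bracket: "\<lbrakk>X \<in> generated_lie_algebra S; Y \<in> generated_lie_algebra S\<rbrakk>
    \<Longrightarrow> lie_bracket X Y \<in> generated_lie_algebra S"

definition left_invariant :: "'a::euclidean_space monoid \<Rightarrow> ('a \<Rightarrow> 'a) \<Rightarrow> bool" where
  "left_invariant G X \<longleftrightarrow>
     (\<forall>x y. X (x \<otimes>\<^bsub>G\<^esub> y) = frechet_derivative (\<lambda>z. x \<otimes>\<^bsub>G\<^esub> z) (at y) (X y))"


section \<open>Stratified Lie groups\<close>

text \<open>
  The decomposition $\mathbb{R}^N = \mathbb{R}^{N_1}\times\cdots\times\mathbb{R}^{N_k}$ is given by
  a map \<open>w\<close> sending each coordinate index to its layer in \<open>{1..k}\<close>, so that
  $N_i$ is the number of indices that \<open>w\<close> sends to $i$.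
\<close>

definition dilation :: "('n \<Rightarrow> nat) \<Rightarrow> real \<Rightarrow> real ^ 'n \<Rightarrow> real ^ 'n::finite" where
  "dilation w l x = (\<chi> i. l ^ w i * x $ i)"

definition homogeneous_dimension :: "nat \<Rightarrow> ('n::finite \<Rightarrow> nat) \<Rightarrow> nat" where
  "homogeneous_dimension k w = (\<Sum>i=1..k. i * card {j. w j = i})"

definition lie_group :: "'a::euclidean_space monoid \<Rightarrow> bool" where
  "lie_group G \<longleftrightarrow> group G \<and> carrier G = UNIV \<and>
     smooth (\<lambda>(x, y). x \<otimes>\<^bsub>G\<^esub> y) \<and> smooth (\<lambda>x. inv\<^bsub>G\<^esub> x)"

definition first_layer_fields ::
    "(real ^ 'n::finite) monoid \<Rightarrow> ('n \<Rightarrow> nat) \<Rightarrow> (real ^ 'n \<Rightarrow> real ^ 'n) set" where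
  "first_layer_fields G w =
     {X. left_invariant G X \<and> (\<exists>j. w j = 1 \<and> X 0 = axis j 1)}"

definition stratified_lie_group ::
    "(real ^ 'n::finite) monoid \<Rightarrow> nat \<Rightarrow> ('n \<Rightarrow> nat) \<Rightarrow> bool" where
  "stratified_lie_group G k w \<longleftrightarrow>
     lie_group G \<and>
     range w \<subseteq> {1..k} \<and>
     (\<forall>l>0. dilation w l \<in> iso G G) \<and>
     (\<forall>x. dim ((\<lambda>Z. Z x) ` generated_lie_algebra (first_layer_fields G w)) = CARD('n))"

definition homogeneous_quasi_norm ::
    "(real ^ 'n::finite) monoid \<Rightarrow> ('n \<Rightarrow> nat) \<Rightarrow> (real ^ 'n \<Rightarrow> real) \<Rightarrow> bool" where
  "homogeneous_quasi_norm G w \<nu> \<longleftrightarrow>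
     continuous_on UNIV \<nu> \<and>
     (\<forall>x. 0 \<le> \<nu> x) \<and>
     (\<forall>x. \<nu> x = 0 \<longleftrightarrow> x = 0) \<and>
     (\<forall>x. \<nu> (inv\<^bsub>G\<^esub> x) = \<nu> x) \<and>
     (\<forall>l>0. \<forall>x. \<nu> (dilation w l x) = l * \<nu> x)"


section \<open>Fractional Sobolev spaces\<close>

text \<open>
  Functions stand for their classes modulo null sets, with Borel representatives; in particular
  \<open>u \<noteq> 0\<close> in a function space reads \<open>\<not> (AE x in lborel. u x = 0)\<close>.
  On the diagonal the integrands below are \<open>0 / 0 = 0\<close>; the diagonal is a null set.
\<close>

definition kernel ::
    "'a::euclidean_space monoid \<Rightarrow> ('a \<Rightarrow> real) \<Rightarrow> real \<Rightarrow> real \<Rightarrow> real \<Rightarrow> 'a \<Rightarrow> 'a \<Rightarrow> real" where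
  "kernel G \<nu> Q s p x y = \<nu> (inv\<^bsub>G\<^esub> y \<otimes>\<^bsub>G\<^esub> x) powr (Q + p * s)"

definition gagliardo_integrand ::
    "'a::euclidean_space monoid \<Rightarrow> ('a \<Rightarrow> real) \<Rightarrow> real \<Rightarrow> real \<Rightarrow> real
      \<Rightarrow> ('a \<Rightarrow> real) \<Rightarrow> 'a \<times> 'a \<Rightarrow> real" where
  "gagliardo_integrand G \<nu> Q s p u = (\<lambda>(x, y). \<bar>u x - u y\<bar> powr p / kernel G \<nu> Q s p x y)"

text \<open>\<open>seminorm_pow\<close> is the \<open>p\<close>-th power $[u]_{s,p}^p$.\<close>

definition seminorm_pow ::
    "'a::euclidean_space monoid \<Rightarrow> ('a \<Rightarrow> real) \<Rightarrow> real \<Rightarrow> real \<Rightarrow> real \<Rightarrow> ('a \<Rightarrow> real) \<Rightarrow> real" where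
  "seminorm_pow G \<nu> Q s p u =
     (LINT z|(lborel \<Otimes>\<^sub>M lborel). gagliardo_integrand G \<nu> Q s p u z)"

definition W ::
    "'a::euclidean_space monoid \<Rightarrow> ('a \<Rightarrow> real) \<Rightarrow> real \<Rightarrow> real \<Rightarrow> real \<Rightarrow> ('a \<Rightarrow> real) set" where
  "W G \<nu> Q s p = {u. u \<in> borel_measurable lborel \<and>
     integrable lborel (\<lambda>x. \<bar>u x\<bar> powr p) \<and>
     integrable (lborel \<Otimes>\<^sub>M lborel) (gagliardo_integrand G \<nu> Q s p u)}"

definition W_norm ::
    "'a::euclidean_space monoid \<Rightarrow> ('a \<Rightarrow> real) \<Rightarrow> real \<Rightarrow> real \<Rightarrow> real \<Rightarrow> ('a \<Rightarrow> real) \<Rightarrow> real" where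
  "W_norm G \<nu> Q s p u =
     ((LINT x|lborel. \<bar>u x\<bar> powr p) + seminorm_pow G \<nu> Q s p u) powr (1 / p)"

definition W0 ::
    "'a::euclidean_space monoid \<Rightarrow> ('a \<Rightarrow> real) \<Rightarrow> real \<Rightarrow> real \<Rightarrow> real \<Rightarrow> ('a \<Rightarrow> real) set" where
  "W0 G \<nu> Q s p = {u \<in> W G \<nu> Q s p.
     \<forall>e>0. \<exists>f. test_function f \<and> f \<in> W G \<nu> Q s p \<and> W_norm G \<nu> Q s p (\<lambda>x. u x - f x) < e}"


section \<open>Weak solutions, energy and the best Sobolev constant\<close>

definition weak_form ::
    "'a::euclidean_space monoid \<Rightarrow> ('a \<Rightarrow> real) \<Rightarrow> real \<Rightarrow> real \<Rightarrow> real \<Rightarrow> real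
      \<Rightarrow> ('a \<Rightarrow> real) \<Rightarrow> ('a \<Rightarrow> real) \<Rightarrow> real" where
  "weak_form G \<nu> Q s p q u \<psi> =
     (LINT (x, y)|(lborel \<Otimes>\<^sub>M lborel).
        \<bar>u x - u y\<bar> powr (p - 2) * (u x - u y) * (\<psi> x - \<psi> y) / kernel G \<nu> Q s p x y) +
     (LINT x|lborel. \<bar>u x\<bar> powr (p - 2) * u x * \<psi> x - \<bar>u x\<bar> powr (q - 2) * u x * \<psi> x)"

definition weak_solution ::
    "'a::euclidean_space monoid \<Rightarrow> ('a \<Rightarrow> real) \<Rightarrow> real \<Rightarrow> real \<Rightarrow> real \<Rightarrow> real
      \<Rightarrow> ('a \<Rightarrow> real) \<Rightarrow> bool" where
  "weak_solution G \<nu> Q s p q u \<longleftrightarrow>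
     u \<in> W0 G \<nu> Q s p \<and> (\<forall>\<psi>\<in>W0 G \<nu> Q s p. weak_form G \<nu> Q s p q u \<psi> = 0)"

definition energy ::
    "'a::euclidean_space monoid \<Rightarrow> ('a \<Rightarrow> real) \<Rightarrow> real \<Rightarrow> real \<Rightarrow> real \<Rightarrow> real
      \<Rightarrow> ('a \<Rightarrow> real) \<Rightarrow> real" where
  "energy G \<nu> Q s p q u =
     1 / p * seminorm_pow G \<nu> Q s p u
     + 1 / p * (LINT x|lborel. \<bar>u x\<bar> powr p)
     - 1 / q * (LINT x|lborel. \<bar>u x\<bar> powr q)"

definition nehari_functional ::
    "'a::euclidean_space monoid \<Rightarrow> ('a \<Rightarrow> real) \<Rightarrow> real \<Rightarrow> real \<Rightarrow> real \<Rightarrow> real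
      \<Rightarrow> ('a \<Rightarrow> real) \<Rightarrow> real" where
  "nehari_functional G \<nu> Q s p q u =
     seminorm_pow G \<nu> Q s p u + (LINT x|lborel. \<bar>u x\<bar> powr p - \<bar>u x\<bar> powr q)"

definition nehari_set ::
    "'a::euclidean_space monoid \<Rightarrow> ('a \<Rightarrow> real) \<Rightarrow> real \<Rightarrow> real \<Rightarrow> real \<Rightarrow> real
      \<Rightarrow> ('a \<Rightarrow> real) set" where
  "nehari_set G \<nu> Q s p q = {u \<in> W0 G \<nu> Q s p.
     \<not> (AE x in lborel. u x = 0) \<and> nehari_functional G \<nu> Q s p q u = 0}"

definition nonzero_solutions ::
    "'a::euclidean_space monoid \<Rightarrow> ('a \<Rightarrow> real) \<Rightarrow> real \<Rightarrow> real \<Rightarrow> real \<Rightarrow> real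
      \<Rightarrow> ('a \<Rightarrow> real) set" where
  "nonzero_solutions G \<nu> Q s p q =
     {u. weak_solution G \<nu> Q s p q u \<and> \<not> (AE x in lborel. u x = 0)}"

definition least_energy_solution ::
    "'a::euclidean_space monoid \<Rightarrow> ('a \<Rightarrow> real) \<Rightarrow> real \<Rightarrow> real \<Rightarrow> real \<Rightarrow> real
      \<Rightarrow> ('a \<Rightarrow> real) \<Rightarrow> bool" where
  "least_energy_solution G \<nu> Q s p q u \<longleftrightarrow>
     u \<in> nonzero_solutions G \<nu> Q s p q \<and>
     (\<forall>v\<in>nonzero_solutions G \<nu> Q s p q. energy G \<nu> Q s p q u \<le> energy G \<nu> Q s p q v)"

text \<open>
  The left-hand side of the Sobolev inequality is an integral of a nonnegative function with
  values in $[0,\infty]$, so the inequality includes that it is finite. As the Bochner integral of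
  a non-integrable function is \<open>0\<close>, integrability is required explicitly.
\<close>

definition sobolev_inequality ::
    "'a::euclidean_space monoid \<Rightarrow> ('a \<Rightarrow> real) \<Rightarrow> real \<Rightarrow> real \<Rightarrow> real \<Rightarrow> real \<Rightarrow> real \<Rightarrow> bool" where
  "sobolev_inequality G \<nu> Q s p q C \<longleftrightarrow> (\<forall>u\<in>W0 G \<nu> Q s p.
     integrable lborel (\<lambda>x. \<bar>u x\<bar> powr q) \<and>
     (LINT x|lborel. \<bar>u x\<bar> powr q) powr (p / q)
       \<le> C * (seminorm_pow G \<nu> Q s p u + (LINT x|lborel. \<bar>u x\<bar> powr p)))"

definition best_sobolev_constant ::
    "'a::euclidean_space monoid \<Rightarrow> ('a \<Rightarrow> real) \<Rightarrow> real \<Rightarrow> real \<Rightarrow> real \<Rightarrow> real \<Rightarrow> real \<Rightarrow> bool" where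
  "best_sobolev_constant G \<nu> Q s p q C \<longleftrightarrow>
     0 < C \<and> sobolev_inequality G \<nu> Q s p q C \<and>
     (\<forall>C'>0. sobolev_inequality G \<nu> Q s p q C' \<longrightarrow> C \<le> C')"

lemma best_sobolev_constant_inverse:
  assumes C: "best_sobolev_constant G \<nu> Q s p q C" and pq: "0 < p" "0 < q"
  shows "inverse C = (INF u\<in>{u \<in> W0 G \<nu> Q s p. \<not> (AE x in lborel. u x = 0)}.
    (seminorm_pow G \<nu> Q s p u + (LINT x|lborel. \<bar>u x\<bar> powr p))
      / (LINT x|lborel. \<bar>u x\<bar> powr q) powr (p / q))"
proof -
  define S where "S = {u \<in> W0 G \<nu> Q s p. \<not> (AE x in lborel. u x = 0)}"
  define E where "E u = seminorm_pow G \<nu> Q s p u + (LINT x|lborel. \<bar>u x\<bar> powr p)" for u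
  define L where "L u = (LINT x|lborel. \<bar>u x\<bar> powr q) powr (p / q)" for u :: "'a \<Rightarrow> real"
  have C0: "C > 0" and SC: "sobolev_inequality G \<nu> Q s p q C"
    and least: "\<And>C'. C' > 0 \<Longrightarrow> sobolev_inequality G \<nu> Q s p q C' \<Longrightarrow> C \<le> C'"
    using C unfolding best_sobolev_constant_def by auto
  have int: "integrable lborel (\<lambda>x. \<bar>u x\<bar> powr q)" and le: "L u \<le> C * E u"
    if "u \<in> W0 G \<nu> Q s p" for u
    using SC that unfolding sobolev_inequality_def L_def E_def by auto
  have E0: "E u \<ge> 0" for u
    unfolding E_def seminorm_pow_def gagliardo_integrand_def kernel_def
    by (intro add_nonneg_nonneg integral_nonneg_AE) (auto simp: split_beta)
  have L0: "L u > 0" if "u \<in> S" for u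
  proof -
    have "(LINT x|lborel. \<bar>u x\<bar> powr q) \<noteq> 0"
      using integral_nonneg_eq_0_iff_AE[OF int[of u]] that pq unfolding S_def by auto
    then show ?thesis
      unfolding L_def by (simp add: less_le)
  qed
  have triv: "L u = 0" if "u \<in> W0 G \<nu> Q s p" "u \<notin> S" for u
  proof -
    have "AE x in lborel. \<bar>u x\<bar> powr q = 0"
      using that unfolding S_def by auto
    then have "(LINT x|lborel. \<bar>u x\<bar> powr q) = 0"
      by (rule integral_eq_zero_AE)
    then show ?thesis unfolding L_def using pq by simp
  qed
  have sobI: "sobolev_inequality G \<nu> Q s p q C'"
    if "C' > 0" "\<And>u. u \<in> S \<Longrightarrow> L u \<le> C' * E u" for C'
  proof -
    have "L u \<le> C' * E u" if u: "u \<in> W0 G \<nu> Q s p" for u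
      using that(1) triv[OF u] \<open>C' > 0\<close> \<open>\<And>u. u \<in> S \<Longrightarrow> L u \<le> C' * E u\<close>[of u] E0[of u]
      by (cases "u \<in> S") auto
    then show ?thesis
      using int unfolding sobolev_inequality_def L_def E_def by auto
  qed
  have ne: "S \<noteq> {}"
  proof
    assume "S = {}"
    then have "sobolev_inequality G \<nu> Q s p q (C / 2)"
      by (intro sobI) (use C0 in auto)
    then show False using least[of "C / 2"] C0 by auto
  qed
  have lower: "inverse C \<le> E u / L u" if "u \<in> S" for u
    using le[of u] L0[OF that] C0 that by (simp add: S_def field_simps)
  have "(INF u\<in>S. E u / L u) = inverse C"
  proof (rule cInf_eq_non_empty)
    show "(\<lambda>u. E u / L u) ` S \<noteq> {}" using ne by simp
    show "inverse C \<le> x" if "x \<in> (\<lambda>u. E u / L u) ` S" for x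
      using that lower by auto
    fix y assume y: "\<And>x. x \<in> (\<lambda>u. E u / L u) ` S \<Longrightarrow> y \<le> x"
    show "y \<le> inverse C"
    proof (cases "y > 0")
      case True
      have "sobolev_inequality G \<nu> Q s p q (inverse y)"
      proof (rule sobI)
        show "L u \<le> inverse y * E u" if "u \<in> S" for u
          using y[OF imageI[OF that]] L0[OF that] True by (simp add: field_simps)
      qed (use True in simp)
      then have "C \<le> inverse y" using least True by simp
      then show ?thesis using C0 True by (simp add: field_simps)
    next
      case False
      have "0 < inverse C" using C0 by simp
      with False show ?thesis by linarith
    qed
  qed
  then show ?thesis unfolding S_def E_def L_def by simp
qed

end

(* A weak solution tested against itself lies on the Nehari set, where the energy is
   (1/p - 1/q) times the integral of |u|^q. Every u <> 0 has a positive multiple on the Nehari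
   set, so minimality of phi there makes phi a minimiser of the scaling-invariant Sobolev quotient,
   which gives 1/C in terms of d. As the space is invariant under u -> u o D_l, the minimality at
   l = 1 along this curve yields the Pohozaev identity relating the integrals of |phi|^p and
   |phi|^q. *)
theory Submission
  imports Defs
begin

section \<open>Dilations\<close>

text \<open>By the chain rule, the derivative of \<open>\<lambda>x. f (L x)\<close> in direction
  \<open>v\<close> is the derivative of \<open>f\<close> in the fixed direction \<open>L v\<close>,
  again composed with \<open>L\<close>. The induction therefore generalizes over \<open>f\<close>.
  With \<open>L\<close> a dilation this keeps test functions smooth.\<close>

lemma smooth_compose_linear:
  fixes f :: "'a::euclidean_space \<Rightarrow> 'b::real_normed_vector" and L :: "'c::euclidean_space \<Rightarrow> 'a"
  assumes "smooth f" and L: "linear L"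
  shows "smooth (\<lambda>x. f (L x))"
proof -
  have "Ck k (\<lambda>x. f (L x))" if "Ck k f" for k and f :: "'a \<Rightarrow> 'b"
    using that
  proof (induction k arbitrary: f)
    case 0
    then show ?case
      using linear_continuous_on[of L UNIV] L
      by (auto intro: continuous_on_compose2 simp: linear_linear)
  next
    case (Suc k)
    have "((\<lambda>x. f (L x)) has_derivative (\<lambda>v. frechet_derivative f (at (L x)) (L v))) (at x)" for x
    proof -
      have "(f has_derivative frechet_derivative f (at (L x))) (at (L x))"
        using Suc.prems by (simp add: frechet_derivative_works)
      moreover have "(L has_derivative L) (at x)"
        using L by (simp add: bounded_linear_imp_has_derivative linear_linear)
      ultimately show ?thesis by (rule has_derivative_compose[rotated])
    qed
    then have "frechet_derivative (\<lambda>x. f (L x)) (at x) = (\<lambda>v. frechet_derivative f (at (L x)) (L v))"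
      and "(\<lambda>x. f (L x)) differentiable (at x)" for x
      by (auto simp: frechet_derivative_at[symmetric] differentiable_def)
    then show ?case
      using Suc.IH[of "\<lambda>x. frechet_derivative f (at x) (L _)"] Suc.prems by simp
  qed
  then show ?thesis using assms(1) by (simp add: smooth_def)
qed

lemma smooth_scaleR:
  fixes f :: "'a::euclidean_space \<Rightarrow> 'b::real_normed_vector"
  assumes "smooth f"
  shows "smooth (\<lambda>x. c *\<^sub>R f x)"
proof -
  have "Ck k (\<lambda>x. c *\<^sub>R f x)" if "Ck k f" for k and f :: "'a \<Rightarrow> 'b"
    using that
  proof (induction k arbitrary: f)
    case 0
    then show ?case by (auto intro: continuous_intros)
  next
    case (Suc k)
    have "((\<lambda>x. c *\<^sub>R f x) has_derivative (\<lambda>v. c *\<^sub>R frechet_derivative f (at x) v)) (at x)" for x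
      using Suc.prems by (intro has_derivative_scaleR_right) (simp add: frechet_derivative_works)
    then have "frechet_derivative (\<lambda>x. c *\<^sub>R f x) (at x) = (\<lambda>v. c *\<^sub>R frechet_derivative f (at x) v)"
      and "(\<lambda>x. c *\<^sub>R f x) differentiable (at x)" for x
      by (auto simp: frechet_derivative_at[symmetric] differentiable_def)
    then show ?case
      using Suc.IH[of "\<lambda>x. frechet_derivative f (at x) _"] Suc.prems by simp
  qed
  then show ?thesis using assms by (simp add: smooth_def)
qed

lemma linear_dilation: "linear (dilation w l)"
  by (rule linearI) (simp_all add: dilation_def vec_eq_iff algebra_simps)

lemma dilation_dilation: "dilation w l (dilation w m x) = dilation w (l * m) x"
  by (simp add: dilation_def vec_eq_iff power_mult_distrib)

lemma dilation_1 [simp]: "dilation w 1 x = x"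
  by (simp add: dilation_def vec_eq_iff)

lemma dilation_inverse [simp]:
  assumes "l \<noteq> 0"
  shows "dilation w (inverse l) (dilation w l x) = x" "dilation w l (dilation w (inverse l) x) = x"
  using assms by (simp_all add: dilation_dilation)

section \<open>Change of variables for dilations\<close>

lemma borel_measurable_dilation [measurable]: "dilation w l \<in> borel \<rightarrow>\<^sub>M borel"
  by (intro borel_measurable_continuous_onI linear_continuous_on)
     (simp add: linear_linear linear_dilation)

text \<open>Grouping the coordinates by layer identifies \<open>Q\<close> with the exponent of the
  Jacobian determinant of a dilation.\<close>

lemma homogeneous_dimension_eq:
  assumes "range w \<subseteq> {1..k}"
  shows "homogeneous_dimension k w = (\<Sum>i\<in>UNIV. w i)"
proof -
  have "(\<Sum>i\<in>UNIV. w i) = (\<Sum>i\<in>{1..k}. \<Sum>j\<in>{j \<in> UNIV. w j = i}. w j)"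
    using assms by (intro sum.group[symmetric]) auto
  also have "\<dots> = homogeneous_dimension k w"
    unfolding homogeneous_dimension_def by (intro sum.cong) auto
  finally show ?thesis ..
qed

text \<open>A dilation is diagonal in the standard basis, so its Jacobian determinant is the product
  of the factors \<open>l ^ w i\<close>.\<close>

lemma lborel_eq_density_dilation:
  fixes w :: "'n::finite \<Rightarrow> nat"
  assumes "0 < l"
  shows "(lborel :: (real ^ 'n) measure) =
    density (distr lborel borel (dilation w l)) (\<lambda>_. ennreal (l ^ (\<Sum>i\<in>UNIV. w i)))"
proof -
  \<comment> \<open>\<open>lborel_affine_euclidean\<close> takes its scaling factors indexed by
    basis vectors, so the coordinate index is recovered from \<open>b\<close>; it is unique when
    \<open>b\<close> is an axis vector. The translation part is \<open>0\<close>.\<close>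
  define c where "c b = l ^ w (SOME i. b = axis i 1)" for b :: "real ^ 'n"
  have c: "c (axis i 1) = l ^ w i" for i
    by (simp add: c_def axis_eq_axis)
  have Basis: "(Basis :: (real ^ 'n) set) = (\<lambda>i. axis i 1) ` UNIV"
    by (auto simp: Basis_vec_def)
  have inj: "inj (\<lambda>i::'n. axis i (1::real))"
    by (auto simp: inj_def axis_eq_axis)
  have T: "(0 + (\<Sum>j\<in>Basis. (c j * (x \<bullet> j)) *\<^sub>R j)) = dilation w l x" for x
  proof -
    have "(\<Sum>j\<in>Basis. (c j * (x \<bullet> j)) *\<^sub>R j) = (\<Sum>i\<in>UNIV. (l ^ w i * x $ i) *\<^sub>R axis i 1)"
      by (subst Basis, subst sum.reindex[OF inj]) (simp add: c cart_eq_inner_axis)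
    then show ?thesis
      by (simp add: dilation_def vec_eq_iff axis_def if_distrib[of "\<lambda>t. _ * t"] cong: if_cong)
  qed
  have "(\<Prod>j\<in>Basis. \<bar>c j\<bar>) = l ^ (\<Sum>i\<in>UNIV. w i)"
    using assms by (subst Basis, subst prod.reindex[OF inj]) (simp add: c power_sum)
  moreover have "c j \<noteq> 0" for j using assms by (simp add: c_def)
  ultimately show ?thesis
    using lborel_affine_euclidean[of c 0] unfolding T by metis
qed

lemma distr_dilation_eq_density:
  fixes w :: "'n::finite \<Rightarrow> nat"
  assumes "0 < l"
  shows "distr (lborel :: (real ^ 'n) measure) lborel (dilation w l) =
    density lborel (\<lambda>_. ennreal (1 / l ^ (\<Sum>i\<in>UNIV. w i)))" (is "?D = _")
proof -
  have eq: "distr lborel borel (dilation w l) = ?D" by (intro distr_cong) auto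
  \<comment> \<open>The two densities are reciprocal, so imposing both on the pushforward leaves it
    unchanged, while the first alone turns it into \<open>lborel\<close>.\<close>
  have "ennreal (l ^ (\<Sum>i\<in>UNIV. w i)) * ennreal (1 / l ^ (\<Sum>i\<in>UNIV. w i)) = 1"
    using assms by (simp flip: ennreal_mult)
  then have "?D = density (density ?D (\<lambda>_. ennreal (l ^ (\<Sum>i\<in>UNIV. w i))))
      (\<lambda>_. ennreal (1 / l ^ (\<Sum>i\<in>UNIV. w i)))"
    by (simp add: density_density_eq density_1)
  also have "\<dots> = density lborel (\<lambda>_. ennreal (1 / l ^ (\<Sum>i\<in>UNIV. w i)))"
    using lborel_eq_density_dilation[OF assms, of w] eq by simp
  finally show ?thesis .
qed

abbreviation (input) dilation2 ::
    "('n \<Rightarrow> nat) \<Rightarrow> real \<Rightarrow> (real ^ 'n) \<times> (real ^ 'n) \<Rightarrow> (real ^ 'n::finite) \<times> (real ^ 'n)"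
  where "dilation2 w l \<equiv> \<lambda>(x, y). (dilation w l x, dilation w l y)"

text \<open>The pushforward of the product is the product of the pushforwards, and each factor
  contributes one Jacobian.\<close>

lemma distr_dilation2_eq_density:
  fixes w :: "'n::finite \<Rightarrow> nat"
  assumes "0 < l"
  shows "distr ((lborel :: (real ^ 'n) measure) \<Otimes>\<^sub>M lborel) (lborel \<Otimes>\<^sub>M lborel) (dilation2 w l) =
    density (lborel \<Otimes>\<^sub>M lborel) (\<lambda>_. ennreal (1 / l ^ (\<Sum>i\<in>UNIV. w i)) * ennreal (1 / l ^ (\<Sum>i\<in>UNIV. w i)))"
proof -
  let ?D = "density (lborel :: (real ^ 'n) measure) (\<lambda>_. ennreal (1 / l ^ (\<Sum>i\<in>UNIV. w i)))"
  \<comment> \<open>Both product rules below need sigma-finiteness, which holds because the density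
    is finite.\<close>
  have sf: "sigma_finite_measure ?D"
    using assms by (subst sigma_finite_measure.sigma_finite_iff_density_finite[OF sigma_finite_lborel]) auto
  have "distr (lborel \<Otimes>\<^sub>M lborel) (lborel \<Otimes>\<^sub>M lborel) (dilation2 w l) =
      distr lborel lborel (dilation w l) \<Otimes>\<^sub>M distr lborel lborel (dilation w l)"
    by (rule pair_measure_distr[symmetric])
       (use sf assms in \<open>simp_all add: distr_dilation_eq_density\<close>)
  also have "\<dots> = ?D \<Otimes>\<^sub>M ?D" using assms by (simp add: distr_dilation_eq_density)
  also have "\<dots> = density (lborel \<Otimes>\<^sub>M lborel)
      (\<lambda>(x, y). ennreal (1 / l ^ (\<Sum>i\<in>UNIV. w i)) * ennreal (1 / l ^ (\<Sum>i\<in>UNIV. w i)))"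
    by (rule pair_measure_density) (use sf in \<open>simp_all add: sigma_finite_lborel\<close>)
  finally show ?thesis unfolding case_prod_beta .
qed

text \<open>Common change of variables for \<open>dilation\<close> on the group and
  \<open>dilation2\<close> on pairs.\<close>

lemma integral_compose_distr_density:
  fixes f :: "'a \<Rightarrow> real"
  assumes T: "T \<in> M \<rightarrow>\<^sub>M M" and D: "distr M M T = density M (\<lambda>_. ennreal c)" "0 \<le> c"
    and f: "integrable M f"
  shows "integrable M (\<lambda>x. f (T x))" "(LINT x|M. f (T x)) = c * (LINT x|M. f x)"
proof -
  have m: "f \<in> borel_measurable M" using f by auto
  have "integrable (density M (\<lambda>_. ennreal c)) f"
    using D f m by (subst integrable_density) auto
  then show "integrable M (\<lambda>x. f (T x))"
    using integrable_distr_eq[OF T m] D by simp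
  show "(LINT x|M. f (T x)) = c * (LINT x|M. f x)"
    using integral_distr[OF T m] integral_density[OF m, of "\<lambda>_. c"] D by simp
qed

lemma integral_dilation:
  fixes f :: "real ^ 'n::finite \<Rightarrow> real" and f2 :: "(real ^ 'n) \<times> (real ^ 'n) \<Rightarrow> real"
  assumes "0 < l"
  shows "integrable lborel (\<lambda>x. f (dilation w l x)) \<longleftrightarrow> integrable lborel f" (is "?L1 \<longleftrightarrow> ?R1")
    and "integrable (lborel \<Otimes>\<^sub>M lborel) (\<lambda>z. f2 (dilation2 w l z)) \<longleftrightarrow> integrable (lborel \<Otimes>\<^sub>M lborel) f2"
      (is "?L2 \<longleftrightarrow> ?R2")
    and "(LINT x|lborel. f (dilation w l x)) = (LINT x|lborel. f x) / l ^ (\<Sum>i\<in>UNIV. w i)"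
    and "(LINT z|(lborel \<Otimes>\<^sub>M lborel). f2 (dilation2 w l z)) =
      (LINT z|(lborel \<Otimes>\<^sub>M lborel). f2 z) / (l ^ (\<Sum>i\<in>UNIV. w i))\<^sup>2"
proof -
  have m1: "dilation w l \<in> lborel \<rightarrow>\<^sub>M lborel" for l by simp
  have m2: "dilation2 w l \<in> lborel \<Otimes>\<^sub>M lborel \<rightarrow>\<^sub>M lborel \<Otimes>\<^sub>M lborel" for l by simp
  have d2: "distr (lborel \<Otimes>\<^sub>M lborel) (lborel \<Otimes>\<^sub>M lborel) (dilation2 w l) =
    density (lborel \<Otimes>\<^sub>M lborel) (\<lambda>_. ennreal (1 / (l ^ (\<Sum>i\<in>UNIV. w i))\<^sup>2))" if "0 < l" for l
    using that by (simp add: distr_dilation2_eq_density power2_eq_square flip: ennreal_mult)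
  note s1 = integral_compose_distr_density[OF m1 distr_dilation_eq_density]
  note s2 = integral_compose_distr_density[OF m2 d2]
  show i1: "?L1 \<longleftrightarrow> ?R1"
  proof
    \<comment> \<open>The converse is the forward direction for the inverse dilation, applied to the
      dilated function.\<close>
    assume ?L1
    then show ?R1
      using s1(1)[of "inverse l" "\<lambda>x. f (dilation w l x)"] assms by simp
  qed (use s1(1)[of l f] assms in simp)
  show i2: "?L2 \<longleftrightarrow> ?R2"
  proof
    assume ?L2
    then show ?R2
      using s2(1)[of "inverse l" "\<lambda>z. f2 (dilation2 w l z)"] assms by (simp add: split_beta)
  qed (use s2(1)[of l f2] assms in simp)
  \<comment> \<open>No integrability is assumed: if it fails, it fails on both sides, and both
    integrals take the default value \<open>0\<close>.\<close>
  show "(LINT x|lborel. f (dilation w l x)) = (LINT x|lborel. f x) / l ^ (\<Sum>i\<in>UNIV. w i)"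
    using s1(2)[of l f] i1 assms by (cases ?R1) (simp_all add: not_integrable_integral_eq)
  show "(LINT z|(lborel \<Otimes>\<^sub>M lborel). f2 (dilation2 w l z)) =
      (LINT z|(lborel \<Otimes>\<^sub>M lborel). f2 z) / (l ^ (\<Sum>i\<in>UNIV. w i))\<^sup>2"
    using s2(2)[of l f2] i2 assms by (cases ?R2) (simp_all add: not_integrable_integral_eq)
qed


section \<open>Invariance of the fractional Sobolev space\<close>

text \<open>A dilation is a group automorphism and hence commutes with forming
  \<open>y^-1 x\<close>; the homogeneity of \<open>\<nu>\<close> then extracts the power of
  \<open>l\<close>.\<close>

lemma kernel_dilation:
  assumes G: "stratified_lie_group G k w" and \<nu>: "homogeneous_quasi_norm G w \<nu>" and l: "0 < l"
  shows "kernel G \<nu> Q s p (dilation w l x) (dilation w l y) =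
    l powr (Q + p * s) * kernel G \<nu> Q s p x y"
proof -
  have grp: "group G" "carrier G = UNIV" and D: "dilation w l \<in> hom G G"
    using G l by (auto simp: stratified_lie_group_def lie_group_def iso_def)
  interpret group_hom G G "dilation w l"
    using grp(1) D by (intro group_hom.intro group_hom_axioms.intro)
  have "inv\<^bsub>G\<^esub> dilation w l y \<otimes>\<^bsub>G\<^esub> dilation w l x = dilation w l (inv\<^bsub>G\<^esub> y \<otimes>\<^bsub>G\<^esub> x)"
    using hom_mult[of "inv\<^bsub>G\<^esub> y" x] hom_inv[of y] grp(2) by simp
  then show ?thesis
    using \<nu> l by (simp add: kernel_def homogeneous_quasi_norm_def powr_mult)
qed

lemma gagliardo_integrand_dilation:
  assumes "stratified_lie_group G k w" "homogeneous_quasi_norm G w \<nu>" "0 < l"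
  shows "gagliardo_integrand G \<nu> Q s p (\<lambda>x. u (dilation w l x)) z =
    l powr (Q + p * s) * gagliardo_integrand G \<nu> Q s p u (dilation2 w l z)"
  using assms by (cases z) (simp add: gagliardo_integrand_def kernel_dilation[OF assms])

lemma integral_abs_powr_dilation:
  fixes u :: "real ^ 'n::finite \<Rightarrow> real"
  assumes "stratified_lie_group G k w" "0 < l" "Q = real (homogeneous_dimension k w)"
  shows "(LINT x|lborel. \<bar>u (dilation w l x)\<bar> powr r) = l powr (- Q) * (LINT x|lborel. \<bar>u x\<bar> powr r)"
proof -
  have "Q = real (\<Sum>i\<in>UNIV. w i)"
    using assms homogeneous_dimension_eq[of w k] by (simp add: stratified_lie_group_def)
  then show ?thesis
    using integral_dilation(3)[OF assms(2), of "\<lambda>x. \<bar>u x\<bar> powr r" w] assms(2)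
    by (simp add: powr_minus powr_realpow field_simps flip: of_nat_sum)
qed

text \<open>The kernel contributes \<open>l powr (Q + p * s)\<close> and the two changes of
  variables \<open>l powr (- 2 * Q)\<close>. The resulting exponent differs by \<open>p * s\<close>
  from that of the Lebesgue integrals; this mismatch gives the Pohozaev identity its
  content.\<close>

lemma seminorm_pow_dilation:
  assumes G: "stratified_lie_group G k w" "homogeneous_quasi_norm G w \<nu>" and l: "0 < l"
    and Q: "Q = real (homogeneous_dimension k w)"
  shows "seminorm_pow G \<nu> Q s p (\<lambda>x. u (dilation w l x)) =
    l powr (p * s - Q) * seminorm_pow G \<nu> Q s p u"
proof -
  have N: "Q = real (\<Sum>i\<in>UNIV. w i)"
    using G Q homogeneous_dimension_eq[of w k] by (simp add: stratified_lie_group_def)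
  have "(l ^ (\<Sum>i\<in>UNIV. w i))\<^sup>2 = l powr (2 * Q)"
    using l powr_realpow[of l "2 * (\<Sum>i\<in>UNIV. w i)"] by (simp add: N power_mult mult.commute)
  then have "l powr (Q + p * s) / (l ^ (\<Sum>i\<in>UNIV. w i))\<^sup>2 = l powr (p * s - Q)"
    by (simp flip: powr_diff)
  moreover have "seminorm_pow G \<nu> Q s p (\<lambda>x. u (dilation w l x)) =
      l powr (Q + p * s) * (seminorm_pow G \<nu> Q s p u / (l ^ (\<Sum>i\<in>UNIV. w i))\<^sup>2)"
    unfolding seminorm_pow_def gagliardo_integrand_dilation[OF G l]
    using integral_dilation(4)[OF l, of "gagliardo_integrand G \<nu> Q s p u" w] by simp
  ultimately show ?thesis by (metis times_divide_eq_left times_divide_eq_right)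
qed

lemma W_dilation:
  assumes "stratified_lie_group G k w" "homogeneous_quasi_norm G w \<nu>" "0 < l" "u \<in> W G \<nu> Q s p"
  shows "(\<lambda>x. u (dilation w l x)) \<in> W G \<nu> Q s p"
  using assms(4) integral_dilation(1)[OF assms(3), of "\<lambda>x. \<bar>u x\<bar> powr p" w]
    integral_dilation(2)[OF assms(3), of "gagliardo_integrand G \<nu> Q s p u" w]
  by (auto simp: W_def gagliardo_integrand_dilation[OF assms(1-3), abs_def]
      intro!: measurable_compose[OF borel_measurable_dilation])

lemma gagliardo_integrand_nonneg: "0 \<le> gagliardo_integrand G \<nu> Q s p u z"
  by (cases z) (simp add: gagliardo_integrand_def kernel_def)

lemma seminorm_pow_nonneg: "0 \<le> seminorm_pow G \<nu> Q s p u"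
  unfolding seminorm_pow_def by (intro integral_nonneg_AE) (simp add: gagliardo_integrand_nonneg)

lemma integral_abs_powr_nonneg: "0 \<le> (LINT x|M. \<bar>u x\<bar> powr (r::real))"
  by (intro integral_nonneg_AE) simp

text \<open>The set where the dilated function is nonzero lies in the image of the original one
  under the inverse dilation, hence stays bounded.\<close>

lemma test_function_dilation:
  assumes "test_function f" "l > 0"
  shows "test_function (\<lambda>x. f (dilation w l x))"
proof -
  have "bounded {x. f x \<noteq> 0}"
    using assms(1) compact_imp_bounded bounded_subset[OF _ closure_subset]
    by (auto simp: test_function_def)
  then have "bounded (dilation w (inverse l) ` {x. f x \<noteq> 0})"
    by (rule bounded_linear_image) (simp add: linear_linear linear_dilation)
  moreover have "{x. f (dilation w l x) \<noteq> 0} \<subseteq> dilation w (inverse l) ` {x. f x \<noteq> 0}"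
  proof
    fix x assume "x \<in> {x. f (dilation w l x) \<noteq> 0}"
    then show "x \<in> dilation w (inverse l) ` {x. f x \<noteq> 0}"
      using assms(2) by (intro image_eqI[of _ _ "dilation w l x"]) auto
  qed
  ultimately have "compact (closure {x. f (dilation w l x) \<noteq> 0})"
    using bounded_subset by (simp add: compact_closure) blast
  then show ?thesis
    using assms(1) smooth_compose_linear[OF _ linear_dilation, of f] by (simp add: test_function_def)
qed

text \<open>Dilating an approximating test function approximates the dilated \<open>u\<close>, since
  dilation enlarges the norm by at most a constant factor.\<close>

lemma W0_dilation:
  assumes G: "stratified_lie_group G k w" "homogeneous_quasi_norm G w \<nu>" and l: "0 < l"
    and Q: "Q = real (homogeneous_dimension k w)" and p: "0 < p" and u: "u \<in> W0 G \<nu> Q s p"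
  shows "(\<lambda>x. u (dilation w l x)) \<in> W0 G \<nu> Q s p"
proof -
  \<comment> \<open>The sum of the scaling factors of the two parts of the norm bounds each of
    them.\<close>
  define K where "K = l powr (- Q) + l powr (p * s - Q)"
  have K: "0 < K" using l by (simp add: K_def add_pos_pos)
  have norm: "W_norm G \<nu> Q s p (\<lambda>x. v (dilation w l x)) \<le> K powr (1 / p) * W_norm G \<nu> Q s p v" for v
  proof -
    note nn = integral_abs_powr_nonneg[of lborel v p] seminorm_pow_nonneg[of G \<nu> Q s p v]
    have "l powr (- Q) * (LINT x|lborel. \<bar>v x\<bar> powr p) + l powr (p * s - Q) * seminorm_pow G \<nu> Q s p v
        \<le> K * ((LINT x|lborel. \<bar>v x\<bar> powr p) + seminorm_pow G \<nu> Q s p v)"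
      unfolding K_def distrib_left
      by (intro add_mono mult_right_mono nn) simp_all
    then show ?thesis
      unfolding W_norm_def seminorm_pow_dilation[OF G l Q, of s p v]
        integral_abs_powr_dilation[OF G(1) l Q, of v]
      using nn K p by (subst powr_mult[symmetric]) (auto intro!: powr_mono2)
  qed
  have "\<exists>f. test_function f \<and> f \<in> W G \<nu> Q s p \<and>
      W_norm G \<nu> Q s p (\<lambda>x. u (dilation w l x) - f x) < e" if "e > 0" for e
  proof -
    obtain f where f: "test_function f" "f \<in> W G \<nu> Q s p"
      "W_norm G \<nu> Q s p (\<lambda>x. u x - f x) < e / K powr (1 / p)"
      using u divide_pos_pos[OF \<open>e > 0\<close>, of "K powr (1 / p)"] K unfolding W0_def by auto
    have "W_norm G \<nu> Q s p (\<lambda>x. u (dilation w l x) - f (dilation w l x)) < e"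
      using norm[of "\<lambda>x. u x - f x"] f(3) K by (simp add: field_simps)
    then show ?thesis
      using f test_function_dilation[OF f(1) l] W_dilation[OF G l f(2)] by blast
  qed
  then show ?thesis
    using u W_dilation[OF G l] by (auto simp: W0_def)
qed

section \<open>Invariance under positive multiples\<close>

lemma gagliardo_integrand_mult:
  assumes "0 \<le> t"
  shows "gagliardo_integrand G \<nu> Q s p (\<lambda>x. t * u x) z = t powr p * gagliardo_integrand G \<nu> Q s p u z"
  using assms
  by (cases z) (simp add: gagliardo_integrand_def abs_mult powr_mult flip: right_diff_distrib)

lemma seminorm_pow_mult:
  assumes "0 \<le> t"
  shows "seminorm_pow G \<nu> Q s p (\<lambda>x. t * u x) = t powr p * seminorm_pow G \<nu> Q s p u"
  using assms by (simp add: seminorm_pow_def gagliardo_integrand_mult)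

lemma W_mult:
  assumes "0 \<le> t" "u \<in> W G \<nu> Q s p"
  shows "(\<lambda>x. t * u x) \<in> W G \<nu> Q s p"
  using assms
  by (auto simp: W_def gagliardo_integrand_mult[OF assms(1), abs_def] abs_mult powr_mult)

lemma test_function_mult:
  assumes "test_function f"
  shows "test_function (\<lambda>x. t * f x)"
proof -
  have "{x. t * f x \<noteq> 0} \<subseteq> {x. f x \<noteq> 0}" by auto
  then have "compact (closure {x. t * f x \<noteq> 0})"
    using assms unfolding test_function_def compact_closure by (blast intro: bounded_subset)
  then show ?thesis
    using assms smooth_scaleR[of f t] by (simp add: test_function_def)
qed

lemma W0_mult:
  assumes t: "0 < t" and p: "0 < p" and u: "u \<in> W0 G \<nu> Q s p"
  shows "(\<lambda>x. t * u x) \<in> W0 G \<nu> Q s p"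
proof -
  have norm: "W_norm G \<nu> Q s p (\<lambda>x. t * v x) = t * W_norm G \<nu> Q s p v" for v
    unfolding W_norm_def using t p integral_abs_powr_nonneg[of lborel v p] seminorm_pow_nonneg[of G \<nu> Q s p v]
    by (simp add: seminorm_pow_mult abs_mult powr_mult powr_powr flip: distrib_left)
  have "\<exists>f. test_function f \<and> f \<in> W G \<nu> Q s p \<and> W_norm G \<nu> Q s p (\<lambda>x. t * u x - f x) < e"
    if "e > 0" for e
  proof -
    obtain f where f: "test_function f" "f \<in> W G \<nu> Q s p" "W_norm G \<nu> Q s p (\<lambda>x. u x - f x) < e / t"
      using u divide_pos_pos[OF \<open>e > 0\<close> t] unfolding W0_def by blast
    have "W_norm G \<nu> Q s p (\<lambda>x. t * u x - t * f x) < e"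
      using norm[of "\<lambda>x. u x - f x"] f(3) t by (simp add: field_simps)
    then show ?thesis
      using test_function_mult[OF f(1)] W_mult[OF less_imp_le[OF t] f(2)] by blast
  qed
  then show ?thesis
    using u W_mult[of t u] t by (auto simp: W0_def)
qed

section \<open>The ground state\<close>

text \<open>The identity is the vanishing of the derivative at \<open>l = 1\<close>, where both sides of the
  inequality agree.\<close>

lemma pohozaev_identity:
  fixes A B C Q s p q :: real
  assumes le: "\<And>l. 0 < l \<Longrightarrow> (l powr (- Q) * (A + B)) powr (p / q)
      \<le> C * (l powr (p * s - Q) * A + l powr (- Q) * B)"
    and eq: "(A + B) powr (p / q) = C * (A + B)"
    and C: "0 < C" and q: "0 < q" and AB: "0 \<le> A + B"
  shows "(A + B) * (s * p * q - Q * (q - p)) = s * p * q * B"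
proof -
  \<comment> \<open>The right side of \<open>le\<close> minus its left side, where \<open>eq\<close>
    has replaced the power of \<open>A + B\<close>, so that the left side depends on
    \<open>l\<close> through a single power.\<close>
  define g where "g l = C * (l powr (p * s - Q) * A + l powr (- Q) * B)
      - l powr (- Q * p / q) * (C * (A + B))" for l
  have "(g has_real_derivative C * ((p * s - Q) * A + (- Q) * B) - (- Q * p / q) * (C * (A + B))) (at 1)"
    unfolding g_def by (auto intro!: derivative_eq_intros)
  \<comment> \<open>Here \<open>g 1 = 0\<close> and \<open>g l\<close> is nonnegative by
    \<open>le\<close>; radius \<open>1\<close> keeps \<open>l\<close> positive.\<close>
  moreover have "g 1 \<le> g l" if "\<bar>1 - l\<bar> < 1" for l
  proof -
    have l: "0 < l" using that by simp
    have "(l powr (- Q) * (A + B)) powr (p / q) = l powr (- Q * p / q) * (C * (A + B))"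
      using AB eq by (simp add: powr_mult powr_powr)
    then show ?thesis using le[OF l] by (simp add: g_def)
  qed
  ultimately have "C * ((p * s - Q) * A + (- Q) * B) - (- Q * p / q) * (C * (A + B)) = 0"
    by (intro DERIV_local_min[of g _ 1 1]) auto
  then have "C * ((p * s - Q) * A - Q * B + Q * p / q * (A + B)) = 0"
    by (simp add: algebra_simps add_divide_distrib)
  then have "(p * s - Q) * A - Q * B + Q * p / q * (A + B) = 0" using C by simp
  \<comment> \<open>Multiply by \<open>q\<close> and write \<open>A\<close> as
    \<open>(A + B) - B\<close>.\<close>
  then show ?thesis using q by (simp add: field_simps)
qed

section \<open>Weak solutions and the Nehari set\<close>

lemma weak_form_self:
  assumes "integrable lborel (\<lambda>x. \<bar>u x\<bar> powr p)" "integrable lborel (\<lambda>x. \<bar>u x\<bar> powr q)"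
  shows "weak_form G \<nu> Q s p q u u =
    seminorm_pow G \<nu> Q s p u + (LINT x|lborel. \<bar>u x\<bar> powr p) - (LINT x|lborel. \<bar>u x\<bar> powr q)"
proof -
  \<comment> \<open>At \<open>a = 0\<close> both sides vanish for every exponent, because
    \<open>0 powr r = 0\<close>.\<close>
  have *: "\<bar>a\<bar> powr (r - 2) * a * a = \<bar>a\<bar> powr r" for a r :: real
  proof (cases "a = 0")
    case False
    have "\<bar>a\<bar> powr (r - 2) * (a * a) = \<bar>a\<bar> powr (r - 2) * \<bar>a\<bar> powr 2"
      using False by (simp add: power2_eq_square)
    also have "\<dots> = \<bar>a\<bar> powr r" by (subst powr_add[symmetric]) simp
    finally show ?thesis by (simp add: mult.assoc)
  qed simp
  show ?thesis
    using assms by (simp add: weak_form_def * seminorm_pow_def gagliardo_integrand_def)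
qed

text \<open>The Sobolev inequality supplies the integrability of
  \<open>\<bar>u x\<bar> powr q\<close> that is needed to split the integral of the
  difference.\<close>

lemma nehari_set_iff:
  assumes "sobolev_inequality G \<nu> Q s p q C"
  shows "u \<in> nehari_set G \<nu> Q s p q \<longleftrightarrow> u \<in> W0 G \<nu> Q s p \<and> \<not> (AE x in lborel. u x = 0) \<and>
    seminorm_pow G \<nu> Q s p u + (LINT x|lborel. \<bar>u x\<bar> powr p) = (LINT x|lborel. \<bar>u x\<bar> powr q)"
  using assms
  by (auto simp: nehari_set_def nehari_functional_def sobolev_inequality_def W0_def W_def)

lemma energy_nehari:
  assumes "sobolev_inequality G \<nu> Q s p q C" "u \<in> nehari_set G \<nu> Q s p q"
  shows "energy G \<nu> Q s p q u = (1 / p - 1 / q) * (LINT x|lborel. \<bar>u x\<bar> powr q)"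
  using assms(2) unfolding nehari_set_iff[OF assms(1)] energy_def
  by (simp add: left_diff_distrib flip: distrib_left add_divide_distrib)

text \<open>The multiple \<open>t * u\<close> lies on the Nehari set for \<open>t powr (q - p) = E / L\<close>.\<close>

lemma nehari_quotient_ge:
  assumes pq: "0 < p" "p < q" and sob: "sobolev_inequality G \<nu> Q s p q C" and C: "0 < C"
    and u: "u \<in> W0 G \<nu> Q s p" "\<not> (AE x in lborel. u x = 0)"
    and D: "0 \<le> D" "\<And>v. v \<in> nehari_set G \<nu> Q s p q \<Longrightarrow> (1 / p - 1 / q) * D \<le> energy G \<nu> Q s p q v"
  shows "D powr ((q - p) / q) \<le> (seminorm_pow G \<nu> Q s p u + (LINT x|lborel. \<bar>u x\<bar> powr p))
      / (LINT x|lborel. \<bar>u x\<bar> powr q) powr (p / q)"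
proof -
  define E where "E = seminorm_pow G \<nu> Q s p u + (LINT x|lborel. \<bar>u x\<bar> powr p)"
  define L where "L = (LINT x|lborel. \<bar>u x\<bar> powr q)"
  have "integrable lborel (\<lambda>x. \<bar>u x\<bar> powr q)" and LE: "L powr (p / q) \<le> C * E"
    using sob u(1) by (auto simp: sobolev_inequality_def L_def E_def)
  then have "L \<noteq> 0"
    using integral_nonneg_eq_0_iff_AE[of lborel "\<lambda>x. \<bar>u x\<bar> powr q"] u(2) pq by (simp add: L_def)
  then have L: "0 < L" using integral_abs_powr_nonneg[of lborel u q] unfolding L_def by linarith
  \<comment> \<open>A positive \<open>L\<close> forces \<open>E\<close> to be positive, so that
    \<open>t\<close> below is positive.\<close>
  then have "0 < C * E" using LE by (smt (verit) powr_gt_zero)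
  then have E: "0 < E" using C by (simp add: zero_less_mult_iff)
  define t where "t = (E / L) powr (1 / (q - p))"
  have t: "0 < t" using E L by (simp add: t_def)
  have "t powr (q - p) = E / L" using E L pq by (simp add: t_def powr_powr)
  moreover have "t powr q = t powr p * t powr (q - p)" by (simp flip: powr_add)
  ultimately have tq: "t powr p * E = t powr q * L" using L by simp
  define v where "v = (\<lambda>x. t * u x)"
  have v: "v \<in> W0 G \<nu> Q s p" "\<not> (AE x in lborel. v x = 0)"
    using W0_mult[OF t pq(1) u(1)] u(2) t by (simp_all add: v_def)
  have norms: "(LINT x|lborel. \<bar>v x\<bar> powr r) = t powr r * (LINT x|lborel. \<bar>u x\<bar> powr r)" for r
    using t by (simp add: v_def abs_mult powr_mult)
  have "seminorm_pow G \<nu> Q s p v = t powr p * seminorm_pow G \<nu> Q s p u"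
    using t by (simp add: v_def seminorm_pow_mult)
  then have "v \<in> nehari_set G \<nu> Q s p q"
    using v tq unfolding nehari_set_iff[OF sob] norms E_def L_def by (simp add: distrib_left)
  from D(2)[OF this] energy_nehari[OF sob this]
  have "(1 / p - 1 / q) * D \<le> (1 / p - 1 / q) * (t powr q * L)" by (simp add: norms L_def)
  moreover have "0 < 1 / p - 1 / q" using pq by (simp add: field_simps)
  ultimately have "D \<le> t powr q * L" by simp
  then have "D powr ((q - p) / q) \<le> (t powr q * L) powr ((q - p) / q)"
    using D(1) pq by (intro powr_mono2) auto
  \<comment> \<open>The exponent \<open>(q - p) / q\<close> turns \<open>t powr q\<close> into
    \<open>t powr (q - p) = E / L\<close>, so only the scaling-invariant quotient of
    \<open>u\<close> remains.\<close>
  also have "\<dots> = t powr (q - p) * L powr ((q - p) / q)"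
    using t L pq by (simp add: powr_mult powr_powr)
  also have "L powr ((q - p) / q) = L / L powr (p / q)"
    using L pq by (simp add: diff_divide_distrib powr_diff)
  also have "t powr (q - p) * (L / L powr (p / q)) = E / L powr (p / q)"
    using L \<open>t powr (q - p) = E / L\<close> by simp
  finally show ?thesis by (simp add: E_def L_def)
qed

theorem theorem1p4:
  fixes G :: "(real ^ 'n::finite) monoid"
    and k :: nat and w :: "'n \<Rightarrow> nat"
    and \<nu> :: "real ^ 'n \<Rightarrow> real"
    and Q s p q C d :: real
    and \<phi> :: "real ^ 'n \<Rightarrow> real"
  assumes "stratified_lie_group G k w"
    and "homogeneous_quasi_norm G w \<nu>"
    and "Q = real (homogeneous_dimension k w)"
    and "0 < s" "s < 1" "1 < p"
    and "p * s < Q"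
    and "p < q" "q < Q * p / (Q - p * s)"
    and "best_sobolev_constant G \<nu> Q s p q C"
    and "least_energy_solution G \<nu> Q s p q \<phi>"
    and "d = energy G \<nu> Q s p q \<phi>"
    and "d = (INF u\<in>nehari_set G \<nu> Q s p q. energy G \<nu> Q s p q u)"
  shows "inverse C =
      (s * p * q / (s * p * q - Q * (q - p)) * (LINT x|lborel. \<bar>\<phi> x\<bar> powr p)) powr ((q - p) / q)
    \<and> (s * p * q / (s * p * q - Q * (q - p)) * (LINT x|lborel. \<bar>\<phi> x\<bar> powr p)) powr ((q - p) / q)
      = (p * q / (q - p) * d) powr ((q - p) / q)"
proof -
  note G = assms(1,2) and Q = assms(3)
  have p: "0 < p" and q: "0 < q" using assms by auto
  have C: "0 < C" and sob: "sobolev_inequality G \<nu> Q s p q C"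
    using assms(10) by (auto simp: best_sobolev_constant_def)
  define S where "S = {u \<in> W0 G \<nu> Q s p. \<not> (AE x in lborel. u x = 0)}"
  define E where "E u = seminorm_pow G \<nu> Q s p u + (LINT x|lborel. \<bar>u x\<bar> powr p)" for u
  define A where "A = seminorm_pow G \<nu> Q s p \<phi>"
  define B where "B = (LINT x|lborel. \<bar>\<phi> x\<bar> powr p)"
  define D where "D = (LINT x|lborel. \<bar>\<phi> x\<bar> powr q)"
  have \<phi>: "\<phi> \<in> W0 G \<nu> Q s p" "\<not> (AE x in lborel. \<phi> x = 0)" "weak_form G \<nu> Q s p q \<phi> \<phi> = 0"
    using assms(11) by (auto simp: least_energy_solution_def nonzero_solutions_def weak_solution_def)
  have int: "integrable lborel (\<lambda>x. \<bar>\<phi> x\<bar> powr q)" "integrable lborel (\<lambda>x. \<bar>\<phi> x\<bar> powr p)"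
    using \<phi>(1) sob by (auto simp: sobolev_inequality_def W0_def W_def)
  have AB: "A + B = D" using \<phi>(3) weak_form_self[OF int(2,1)] by (simp add: A_def B_def D_def)
  have "D \<noteq> 0"
    using integral_nonneg_eq_0_iff_AE[OF int(1)] \<phi>(2) q by (simp add: D_def)
  then have D: "0 < D" using integral_abs_powr_nonneg[of lborel \<phi> q] unfolding D_def by linarith
  have \<phi>N: "\<phi> \<in> nehari_set G \<nu> Q s p q"
    using \<phi> AB unfolding nehari_set_iff[OF sob] by (simp add: A_def B_def D_def)
  then have d: "d = (1 / p - 1 / q) * D" using assms(12) energy_nehari[OF sob] by (simp add: D_def)
  have "0 \<le> energy G \<nu> Q s p q v" if "v \<in> nehari_set G \<nu> Q s p q" for v
    unfolding energy_nehari[OF sob that] using p assms(8)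
    by (intro mult_nonneg_nonneg integral_abs_powr_nonneg) (simp add: field_simps)
  \<comment> \<open>The lower bound makes the infimum defining \<open>d\<close> a genuine lower
    bound for every energy on the Nehari set.\<close>
  then have "bdd_below (energy G \<nu> Q s p q ` nehari_set G \<nu> Q s p q)"
    by (intro bdd_belowI2[of _ 0])
  then have least: "(1 / p - 1 / q) * D \<le> energy G \<nu> Q s p q v" if "v \<in> nehari_set G \<nu> Q s p q" for v
    using cINF_lower[OF _ that] assms(13) d by metis
  \<comment> \<open>Since \<open>E \<phi> = D\<close>, the quotient at \<open>\<phi>\<close> equals
    the lower bound of \<open>nehari_quotient_ge\<close>, so the infimum is attained there.\<close>
  have quot: "D powr ((q - p) / q) = E \<phi> / D powr (p / q)"
    using AB D q by (simp add: E_def A_def B_def diff_divide_distrib powr_diff)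
  have "inverse C = (INF u\<in>S. E u / (LINT x|lborel. \<bar>u x\<bar> powr q) powr (p / q))"
    unfolding S_def E_def by (rule best_sobolev_constant_inverse[OF assms(10) p q])
  also have "\<dots> = D powr ((q - p) / q)"
  proof (rule cInf_eq_minimum)
    show "D powr ((q - p) / q) \<in> (\<lambda>u. E u / (LINT x|lborel. \<bar>u x\<bar> powr q) powr (p / q)) ` S"
      using \<phi> quot by (auto simp: S_def D_def)
  next
    fix y assume "y \<in> (\<lambda>u. E u / (LINT x|lborel. \<bar>u x\<bar> powr q) powr (p / q)) ` S"
    then show "D powr ((q - p) / q) \<le> y"
      using nehari_quotient_ge[OF p assms(8) sob C _ _ less_imp_le[OF D] least] by (auto simp: S_def E_def)
  qed
  finally have invC: "inverse C = D powr ((q - p) / q)" .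
  have "D * (s * p * q - Q * (q - p)) = s * p * q * B"
    unfolding AB[symmetric]
  proof (rule pohozaev_identity[where C = C])
    \<comment> \<open>The value of \<open>C\<close> makes the Sobolev inequality an equality at
      \<open>\<phi>\<close>; for the dilates of \<open>\<phi>\<close> it remains an
      inequality.\<close>
    have "inverse C * D powr (p / q) = D"
      unfolding invC using D q by (simp add: diff_divide_distrib flip: powr_add)
    then show "(A + B) powr (p / q) = C * (A + B)" using C AB by (simp add: field_simps)
  next
    fix l :: real assume l: "0 < l"
    show "(l powr (- Q) * (A + B)) powr (p / q) \<le> C * (l powr (p * s - Q) * A + l powr (- Q) * B)"
      using bspec[OF sob[unfolded sobolev_inequality_def] W0_dilation[OF G l Q p \<phi>(1)]]
        seminorm_pow_dilation[OF G l Q, of s p \<phi>] integral_abs_powr_dilation[OF G(1) l Q, of \<phi>]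
      by (simp add: AB) (simp add: A_def B_def D_def)
  qed (use C q AB D in auto)
  \<comment> \<open>This is the subcriticality of \<open>q\<close>, cleared of its denominator
    \<open>Q - p * s > 0\<close>.\<close>
  moreover have "s * p * q - Q * (q - p) > 0"
    using assms(7,9) by (simp add: field_simps)
  ultimately have "s * p * q / (s * p * q - Q * (q - p)) * B = D" by (simp add: field_simps)
  moreover have "p * q / (q - p) * d = D"
    unfolding d using p q assms(8) by (simp add: field_simps)
  ultimately show ?thesis using invC by (simp add: B_def)
qed

end
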